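(* Let $\phi(t)=\sum_{n=0}^\infty t^n\sum_{k=0}^n\binom nk^2\binom{n+k}{k}$. Then for $|k|$ sufficiently small: \[\phi\!\left(k\left(\frac{1-k}{1+k}\right)^2\right)=\frac{(1+k)^2}{\sqrt{(1+k^2)\left((1-k-k^2)^2-5k^2\right)}}\ {}_2F_1\!\left(\frac14,\frac34;1;\frac{64k^5(1+k-k^2)}{(1+k^2)^2\left((1-k-k^2)^2-5k^2\right)^2}\right),\] \[\phi\!\left(k^2\,\frac{1+k}{1-k}\right)=\frac{1-k}{\sqrt{(1+k^2)\left((1+11k-k^2)^2-125k^2\right)}}\ {}_2F_1\!\left(\frac14,\frac34;1;\frac{64k(1+k-k^2)^5}{(1+k^2)^2\left((1+11k-k^2)^2-125k^2\right)^2}\right),\] and \[\phi\!\left(k^2\,\frac{1+k}{1-k}\right)=\frac{1-k}{(1+k)^2}\,\phi\!\left(k\left(\frac{1-k}{1+k}\right)^2\right).\]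
   Context: ${}_2F_1$ denotes the Gauss hypergeometric function; square roots are the principal branches (equal to $1$ at $k=0$). *)

theory Defs
  imports "HOL-Analysis.Analysis"
begin

definition apery_coeff :: "nat \<Rightarrow> nat" where
  "apery_coeff n = (\<Sum>k=0..n. (n choose k)^2 * ((n + k) choose k))"

definition phi :: "complex \<Rightarrow> complex" where
  "phi t = (\<Sum>n. of_nat (apery_coeff n) * t ^ n)"

definition hyp2F1 :: "complex \<Rightarrow> complex \<Rightarrow> complex \<Rightarrow> complex \<Rightarrow> complex" where
  "hyp2F1 a b c z =
     (\<Sum>n. pochhammer a n * pochhammer b n / (pochhammer c n * fact n) * z ^ n)"

end

theory Submission
  imports Defs
begin

text \<open>
  The four functions
  \<open>\<phi>(k((1-k)/(1+k))\<^sup>2) / (1+k)\<^sup>2\<close>, \<open>\<phi>(k\<^sup>2(1+k)/(1-k)) / (1-k)\<close> and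
  \<open>D\<^sup>-\<^sup>1\<^sup>/\<^sup>2 \<cdot> \<^sub>2F\<^sub>1(1/4, 3/4; 1; X)\<close>, for the two pairs \<open>(D, X)\<close>
  in the theorem, all solve one equation \<open>(p y')' = q y\<close> with polynomial \<open>p\<close> and \<open>q\<close>.
  Since \<open>p\<close> vanishes at \<open>0\<close>, the quantity \<open>p\<close> times the Wronskian of two solutions, which is
  constant, is zero. So a solution that is regular at \<open>0\<close> is determined by its value there, which
  is \<open>1\<close> in all four cases. The equation is pulled back from the equations
  \<open>(t(1-11t-t\<^sup>2) \<phi>')' = (3+t) \<phi>\<close> and \<open>(z(1-z) F')' = 3/16 F\<close>.
\<close>

subsection \<open>Sturm--Liouville equations near a point\<close>

definition sturm_liouville ::
    "('a \<Rightarrow> 'a) \<Rightarrow> ('a \<Rightarrow> 'a) \<Rightarrow> ('a \<Rightarrow> 'a) \<Rightarrow> 'a::real_normed_field \<Rightarrow> bool"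
  where "sturm_liouville p q f a \<longleftrightarrow> (\<forall>\<^sub>F x in nhds a.
     (f has_field_derivative deriv f x) (at x) \<and>
     ((\<lambda>x. p x * deriv f x) has_field_derivative q x * f x) (at x))"

lemma sturm_liouvilleI:
  assumes f: "\<forall>\<^sub>F x in nhds a. (f has_field_derivative f' x) (at x)"
    and quasi_deriv: "\<forall>\<^sub>F x in nhds a. p x * f' x = u x"
    and u: "\<forall>\<^sub>F x in nhds a. (u has_field_derivative q x * f x) (at x)"
  shows "sturm_liouville p q f a"
proof -
  have "\<forall>\<^sub>F x in nhds a. p x * deriv f x = u x"
    using f quasi_deriv by eventually_elim (simp add: DERIV_imp_deriv)
  hence "\<forall>\<^sub>F x in nhds a. \<forall>\<^sub>F y in nhds x. p y * deriv f y = u y"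
    by (simp add: eventually_eventually)
  with f u show ?thesis
    unfolding sturm_liouville_def
    by eventually_elim (auto simp: DERIV_deriv_iff_has_field_derivative cong: DERIV_cong_ev)
qed

lemma DERIV_zero_imp_eventually_constant:
  fixes f :: "'a::{real_normed_field, euclidean_space} \<Rightarrow> 'a"
  assumes "isCont f a" "\<forall>\<^sub>F x in at a. (f has_field_derivative 0) (at x)"
  shows "\<forall>\<^sub>F x in nhds a. f x = f a"
proof -
  obtain e where "e > 0" and f': "\<And>x. x \<in> ball a e \<Longrightarrow> x \<noteq> a \<Longrightarrow> (f has_field_derivative 0) (at x)"
    using assms(2) unfolding eventually_at by (auto simp: dist_commute)
  hence "continuous_on (ball a e) f"
    using assms(1) by (metis DERIV_isCont continuous_at_imp_continuous_on)
  hence "f constant_on ball a e"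
    using f' by (intro DERIV_zero_connected_constant_on[where K = "{a}"]) auto
  hence "f x = f a" if "x \<in> ball a e" for x
    using that \<open>e > 0\<close> unfolding constant_on_def by (metis centre_in_ball)
  moreover have "\<forall>\<^sub>F x in nhds a. x \<in> ball a e"
    using \<open>e > 0\<close> by (intro eventually_nhds_in_open) auto
  ultimately show ?thesis
    by (auto elim: eventually_mono)
qed

lemma isCont_imp_eventually_ne:
  fixes f :: "'a::t2_space \<Rightarrow> 'b::t1_space"
  assumes "isCont f a" "f a \<noteq> c"
  shows "\<forall>\<^sub>F x in nhds a. f x \<noteq> c"
  using assms by (simp add: continuous_at tendsto_imp_eventually_ne eventually_nhds_conv_at)

lemma sturm_liouville_wronskian_eq_0:
  fixes f g :: "'a::{real_normed_field, euclidean_space} \<Rightarrow> 'a"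
  assumes f: "sturm_liouville p q f a" and g: "sturm_liouville p q g a" and "p a = 0"
  shows "\<forall>\<^sub>F x in nhds a. p x * (deriv f x * g x - f x * deriv g x) = 0"
proof -
  define u v where "u x = p x * deriv f x" and "v x = p x * deriv g x" for x
  define W where "W x = u x * g x - f x * v x" for x
  have "\<forall>\<^sub>F x in nhds a. (W has_field_derivative 0) (at x)"
    using f g unfolding sturm_liouville_def u_def[symmetric] v_def[symmetric]
  proof eventually_elim
    case (elim x)
    hence "(W has_field_derivative
        q x * f x * g x + deriv g x * u x - (deriv f x * v x + q x * g x * f x)) (at x)"
      unfolding W_def by (auto intro!: derivative_eq_intros)
    thus ?case
      by (rule DERIV_cong) (simp add: u_def v_def)
  qed
  hence "\<forall>\<^sub>F x in nhds a. W x = W a"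
    by (intro DERIV_zero_imp_eventually_constant)
      (auto simp: eventually_at_filter dest: eventually_nhds_x_imp_x
        intro: DERIV_isCont elim: eventually_mono)
  thus ?thesis
    by eventually_elim (simp add: W_def u_def v_def \<open>p a = 0\<close> algebra_simps)
qed

lemma sturm_liouville_proportional:
  fixes f g :: "'a::{real_normed_field, euclidean_space} \<Rightarrow> 'a"
  assumes f: "sturm_liouville p q f a" and g: "sturm_liouville p q g a"
    and p: "p a = 0" "\<forall>\<^sub>F x in at a. p x \<noteq> 0" and "g a \<noteq> 0"
  shows "\<forall>\<^sub>F x in nhds a. f x * g a = f a * g x"
proof -
  have deriv: "\<forall>\<^sub>F x in nhds a. (f has_field_derivative deriv f x) (at x) \<and>
      (g has_field_derivative deriv g x) (at x)"
    using f g unfolding sturm_liouville_def by eventually_elim simp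
  hence cont: "isCont f a" "isCont g a"
    by (auto dest: eventually_nhds_x_imp_x intro: DERIV_isCont)
  hence g_nonzero: "\<forall>\<^sub>F x in nhds a. g x \<noteq> 0"
    using \<open>g a \<noteq> 0\<close> by (intro isCont_imp_eventually_ne)
  have "\<forall>\<^sub>F x in nhds a. x \<noteq> a \<longrightarrow> ((\<lambda>x. f x / g x) has_field_derivative 0) (at x)"
    using deriv g_nonzero sturm_liouville_wronskian_eq_0[OF f g p(1)]
      p(2)[unfolded eventually_at_filter]
  proof eventually_elim
    case (elim x)
    hence "((\<lambda>x. f x / g x) has_field_derivative
        (deriv f x * g x - f x * deriv g x) / (g x * g x)) (at x)"
      using elim by (intro DERIV_divide) auto
    with elim show ?case
      by auto
  qed
  moreover have "isCont (\<lambda>x. f x / g x) a"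
    using cont \<open>g a \<noteq> 0\<close> by (rule isCont_divide)
  ultimately have "\<forall>\<^sub>F x in nhds a. f x / g x = f a / g a"
    by (intro DERIV_zero_imp_eventually_constant) (simp_all add: eventually_at_filter)
  with g_nonzero show ?thesis
    by eventually_elim (simp add: frac_eq_eq \<open>g a \<noteq> 0\<close>)
qed

lemma sturm_liouville_compose:
  assumes f: "sturm_liouville p q f (g a)"
    and g: "\<forall>\<^sub>F x in nhds a. (g has_field_derivative g' x) (at x)"
    and P: "\<forall>\<^sub>F x in nhds a. P x * g' x = c * p (g x)"
  shows "sturm_liouville P (\<lambda>x. c * q (g x) * g' x) (\<lambda>x. f (g x)) a"
proof -
  have "isCont g a"
    using g by (auto dest: eventually_nhds_x_imp_x intro: DERIV_isCont)
  hence "filterlim g (nhds (g a)) (nhds a)"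
    by (simp add: tendsto_nhds_iff continuous_at)
  from f[unfolded sturm_liouville_def] this
  have f': "\<forall>\<^sub>F x in nhds a. (f has_field_derivative deriv f (g x)) (at (g x)) \<and>
      ((\<lambda>x. p x * deriv f x) has_field_derivative q (g x) * f (g x)) (at (g x))"
    by (rule eventually_compose_filterlim)
  show ?thesis
  proof (rule sturm_liouvilleI)
    show "\<forall>\<^sub>F x in nhds a. ((\<lambda>x. f (g x)) has_field_derivative deriv f (g x) * g' x) (at x)"
      using f' g by eventually_elim (auto intro: DERIV_chain2)
    show "\<forall>\<^sub>F x in nhds a. P x * (deriv f (g x) * g' x) = c * (p (g x) * deriv f (g x))"
      using P by eventually_elim (simp add: mult_ac)
    show "\<forall>\<^sub>F x in nhds a. ((\<lambda>x. c * (p (g x) * deriv f (g x))) has_field_derivative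
        c * q (g x) * g' x * f (g x)) (at x)"
      using f' g
    proof eventually_elim
      case (elim x)
      hence "((\<lambda>x. p (g x) * deriv f (g x)) has_field_derivative q (g x) * f (g x) * g' x) (at x)"
        using DERIV_chain2[of "\<lambda>x. p x * deriv f x" _ g x] by blast
      from DERIV_cmult[OF this, of c] show ?case
        by (simp add: mult_ac)
    qed
  qed
qed

lemma sturm_liouville_divide:
  assumes f: "sturm_liouville (\<lambda>x. P x / d x ^ 2) Q f a"
    and d: "\<forall>\<^sub>F x in nhds a. (d has_field_derivative d' x) (at x)" "\<forall>\<^sub>F x in nhds a. d x \<noteq> 0"
    and N: "\<forall>\<^sub>F x in nhds a. ((\<lambda>x. P x * d' x) has_field_derivative N x) (at x)"
    and R: "\<forall>\<^sub>F x in nhds a. R x * d x ^ 2 = Q x * d x ^ 4 - N x * d x + 2 * P x * d' x ^ 2"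
  shows "sturm_liouville P R (\<lambda>x. f x / d x) a"
proof (rule sturm_liouvilleI)
  define u m where "u x = P x / d x ^ 2 * deriv f x" and "m x = P x * d' x" for x
  have f_deriv: "\<forall>\<^sub>F x in nhds a. (f has_field_derivative deriv f x) (at x)"
    using f unfolding sturm_liouville_def by eventually_elim simp
  show "\<forall>\<^sub>F x in nhds a. ((\<lambda>x. f x / d x) has_field_derivative
      (deriv f x * d x - f x * d' x) / (d x * d x)) (at x)"
    using f_deriv d by eventually_elim (rule DERIV_divide)
  show "\<forall>\<^sub>F x in nhds a. P x * ((deriv f x * d x - f x * d' x) / (d x * d x)) =
      d x * u x - m x * f x / d x ^ 2"
    using d(2) by eventually_elim (simp add: u_def m_def field_simps power2_eq_square)
  show "\<forall>\<^sub>F x in nhds a. ((\<lambda>x. d x * u x - m x * f x / d x ^ 2)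
      has_field_derivative R x * (f x / d x)) (at x)"
    using f[unfolded sturm_liouville_def, folded u_def] f_deriv d N[folded m_def] R
  proof eventually_elim
    case (elim x)
    have "R x * (f x / d x) = (R x * d x ^ 2) * f x / d x ^ 3"
      using elim by (simp add: field_simps eval_nat_numeral)
    also have "\<dots> = d x * Q x * f x - N x * f x / d x ^ 2 + 2 * m x * d' x * f x / d x ^ 3"
      unfolding elim m_def using elim by (simp add: field_simps eval_nat_numeral)
    also have "\<dots> = d' x * u x + Q x * f x * d x
          - ((N x * f x + deriv f x * m x) * d x ^ 2 - m x * f x * (2 * d x * d' x)) / d x ^ 4"
      using elim by (simp add: u_def m_def field_simps eval_nat_numeral)
    finally show ?case
      using elim by (auto intro!: derivative_eq_intros)
  qed
qed

lemma eventually_notin_nonpos_Reals: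
  assumes "isCont f a" "f a \<notin> (\<real>\<^sub>\<le>\<^sub>0 :: complex set)"
  shows "\<forall>\<^sub>F x in nhds a. f x \<notin> \<real>\<^sub>\<le>\<^sub>0"
proof -
  have "filterlim f (nhds (f a)) (nhds a)"
    using assms(1) by (simp add: continuous_at tendsto_nhds_iff)
  moreover have "\<forall>\<^sub>F z in nhds (f a). z \<in> - \<real>\<^sub>\<le>\<^sub>0"
    using assms(2) by (intro eventually_nhds_in_open) (auto simp: open_Compl)
  ultimately show ?thesis
    by (auto dest: eventually_compose_filterlim)
qed

lemma has_field_derivative_divide_csqrt:
  assumes "(g has_field_derivative g') (at x)" "(D has_field_derivative D') (at x)" "D x \<notin> \<real>\<^sub>\<le>\<^sub>0"
  shows "((\<lambda>x. g x / csqrt (D x)) has_field_derivative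
    g' / csqrt (D x) - g x * D' / (2 * csqrt (D x) ^ 3)) (at x)"
proof -
  have nonzero: "csqrt (D x) \<noteq> 0"
    using assms(3) by auto
  hence "((\<lambda>x. g x / csqrt (D x)) has_field_derivative
      (g' * csqrt (D x) - g x * (D' / (2 * csqrt (D x)))) / (csqrt (D x) * csqrt (D x))) (at x)"
    using assms by (intro DERIV_divide has_field_derivative_csqrt')
  thus ?thesis
    by (rule DERIV_cong) (use nonzero in \<open>simp add: field_simps power3_eq_cube\<close>)
qed

lemma sturm_liouville_divide_csqrt:
  assumes f: "sturm_liouville (\<lambda>x. P x / D x) Q f a"
    and D: "\<forall>\<^sub>F x in nhds a. (D has_field_derivative D' x) (at x)" "D a \<notin> \<real>\<^sub>\<le>\<^sub>0"
    and N: "\<forall>\<^sub>F x in nhds a. ((\<lambda>x. P x * D' x) has_field_derivative N x) (at x)"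
    and R: "\<forall>\<^sub>F x in nhds a.
      4 * R x * D x ^ 2 = 4 * Q x * D x ^ 3 + 3 * P x * D' x ^ 2 - 2 * N x * D x"
  shows "sturm_liouville P R (\<lambda>x. f x / csqrt (D x)) a"
proof (rule sturm_liouville_divide)
  have "isCont D a"
    using D(1) by (auto dest: eventually_nhds_x_imp_x intro: DERIV_isCont)
  hence off_cut: "\<forall>\<^sub>F x in nhds a. D x \<notin> \<real>\<^sub>\<le>\<^sub>0"
    using D(2) by (rule eventually_notin_nonpos_Reals)
  show "sturm_liouville (\<lambda>x. P x / csqrt (D x) ^ 2) Q f a"
    using f by simp
  show "\<forall>\<^sub>F x in nhds a. csqrt (D x) \<noteq> 0"
    using off_cut by eventually_elim auto
  show "\<forall>\<^sub>F x in nhds a. ((\<lambda>x. csqrt (D x)) has_field_derivative D' x / (2 * csqrt (D x))) (at x)"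
    using off_cut D(1) by eventually_elim (auto intro: has_field_derivative_csqrt')
  show "\<forall>\<^sub>F x in nhds a. ((\<lambda>x. P x * (D' x / (2 * csqrt (D x)))) has_field_derivative
      N x / (2 * csqrt (D x)) - P x * D' x ^ 2 / (4 * csqrt (D x) ^ 3)) (at x)"
    using off_cut D(1) N
  proof eventually_elim
    case (elim x)
    have "((\<lambda>x. P x * D' x / csqrt (D x) / 2) has_field_derivative
        (N x / csqrt (D x) - P x * D' x * D' x / (2 * csqrt (D x) ^ 3)) / 2) (at x)"
      using elim by (intro DERIV_cdivide has_field_derivative_divide_csqrt)
    thus ?case
      by (simp add: diff_divide_distrib power2_eq_square mult_ac)
  qed
  show "\<forall>\<^sub>F x in nhds a. R x * csqrt (D x) ^ 2 = Q x * csqrt (D x) ^ 4 -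
      (N x / (2 * csqrt (D x)) - P x * D' x ^ 2 / (4 * csqrt (D x) ^ 3)) * csqrt (D x) +
      2 * P x * (D' x / (2 * csqrt (D x))) ^ 2"
    using off_cut R
  proof eventually_elim
    case (elim x)
    define s where "s = csqrt (D x)"
    have s: "D x = s ^ 2" "s \<noteq> 0"
      using elim(1) by (auto simp: s_def)
    have "R x * s ^ 2 = 4 * R x * D x ^ 2 / (4 * s ^ 2)"
      using s by (simp add: eval_nat_numeral)
    also have "\<dots> = Q x * s ^ 4 - (N x / (2 * s) - P x * D' x ^ 2 / (4 * s ^ 3)) * s +
        2 * P x * (D' x / (2 * s)) ^ 2"
      unfolding elim(2) unfolding s(1) using s(2) by (simp add: field_simps eval_nat_numeral)
    finally show ?case
      unfolding s_def .
  qed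
qed

subsection \<open>Power series solutions\<close>

lemma sturm_liouville_eval_fps:
  fixes p q F :: "'a::{banach, real_normed_field} fps"
  assumes radius: "fps_conv_radius p > 0" "fps_conv_radius q > 0" "fps_conv_radius F > 0"
    and ode: "fps_deriv (p * fps_deriv F) = q * F"
  shows "sturm_liouville (eval_fps p) (eval_fps q) (eval_fps F) 0"
proof (rule sturm_liouvilleI)
  let ?R = "min (fps_conv_radius p) (min (fps_conv_radius q) (fps_conv_radius F))"
  have deriv_radius: "fps_conv_radius F \<le> fps_conv_radius (fps_deriv F)"
    by (rule fps_conv_radius_deriv)
  have "\<forall>\<^sub>F x in nhds 0. x \<in> eball (0::'a) ?R"
    using radius by (intro eventually_nhds_in_open) (auto simp: zero_ereal_def)
  hence near: "\<forall>\<^sub>F x::'a in nhds 0. ereal (norm x) < fps_conv_radius p \<and>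
      ereal (norm x) < fps_conv_radius q \<and> ereal (norm x) < fps_conv_radius F \<and>
      ereal (norm x) < fps_conv_radius (fps_deriv F)"
    by eventually_elim (use deriv_radius in \<open>auto intro: less_le_trans\<close>)
  show "\<forall>\<^sub>F x in nhds 0. (eval_fps F has_field_derivative eval_fps (fps_deriv F) x) (at x)"
    using near by eventually_elim (simp add: has_field_derivative_eval_fps)
  show "\<forall>\<^sub>F x in nhds 0. eval_fps p x * eval_fps (fps_deriv F) x = eval_fps (p * fps_deriv F) x"
    using near by eventually_elim (simp add: eval_fps_mult)
  show "\<forall>\<^sub>F x in nhds 0. (eval_fps (p * fps_deriv F) has_field_derivative
      eval_fps q x * eval_fps F x) (at x)"
    using near
  proof eventually_elim
    case (elim x)
    hence "ereal (norm x) < fps_conv_radius (p * fps_deriv F)"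
      using less_le_trans[OF _ fps_conv_radius_mult[of p "fps_deriv F"]] by simp
    hence "(eval_fps (p * fps_deriv F) has_field_derivative eval_fps (q * F) x) (at x)"
      using has_field_derivative_eval_fps ode by metis
    thus ?case
      using elim by (simp add: eval_fps_mult)
  qed
qed

lemma fps_sturm_liouville_recurrence:
  fixes F :: "'a::comm_ring_1 fps"
  assumes "p\<^sub>1 * fps_nth F 1 = q\<^sub>0 * fps_nth F 0"
    and "\<And>n. (of_nat n + 2) * (p\<^sub>1 * (of_nat n + 2) * fps_nth F (n + 2) +
        p\<^sub>2 * (of_nat n + 1) * fps_nth F (n + 1) + p\<^sub>3 * of_nat n * fps_nth F n) =
      q\<^sub>0 * fps_nth F (n + 1) + q\<^sub>1 * fps_nth F n"
  shows "fps_deriv (fps_of_poly [:0, p\<^sub>1, p\<^sub>2, p\<^sub>3:] * fps_deriv F) = fps_of_poly [:q\<^sub>0, q\<^sub>1:] * F"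
proof (rule fps_ext)
  fix n
  define G where "G = fps_deriv F"
  have p: "fps_of_poly [:0, p\<^sub>1, p\<^sub>2, p\<^sub>3:] * G = fps_X * (fps_const p\<^sub>1 * G +
      fps_X * (fps_const p\<^sub>2 * G) + fps_X * (fps_X * (fps_const p\<^sub>3 * G)))"
    by (simp add: fps_of_poly_pCons algebra_simps)
  have q: "fps_of_poly [:q\<^sub>0, q\<^sub>1:] * F = fps_const q\<^sub>0 * F + fps_X * (fps_const q\<^sub>1 * F)"
    by (simp add: fps_of_poly_pCons algebra_simps)
  show "fps_nth (fps_deriv (fps_of_poly [:0, p\<^sub>1, p\<^sub>2, p\<^sub>3:] * fps_deriv F)) n =
      fps_nth (fps_of_poly [:q\<^sub>0, q\<^sub>1:] * F) n"
  proof (cases n)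
    case 0
    thus ?thesis
      using assms(1) unfolding G_def[symmetric] p q by (simp add: G_def del: fps_deriv_mult)
  next
    case (Suc m)
    have p\<^sub>3_nth: "fps_nth (fps_X * (fps_X * (fps_const p\<^sub>3 * G))) (Suc m) =
        p\<^sub>3 * of_nat m * fps_nth F m"
      by (cases m) (simp_all add: G_def mult.assoc)
    have "fps_nth (fps_deriv (fps_of_poly [:0, p\<^sub>1, p\<^sub>2, p\<^sub>3:] * fps_deriv F)) n =
        (of_nat m + 2) * (p\<^sub>1 * (of_nat m + 2) * fps_nth F (m + 2) +
          p\<^sub>2 * (of_nat m + 1) * fps_nth F (m + 1) + p\<^sub>3 * of_nat m * fps_nth F m)"
      unfolding G_def[symmetric] p p\<^sub>3_nth[symmetric]
      by (simp add: Suc G_def mult.assoc add_ac del: fps_deriv_mult)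
    also have "\<dots> = fps_nth (fps_of_poly [:q\<^sub>0, q\<^sub>1:] * F) n"
      unfolding assms(2) q by (simp add: Suc)
    finally show ?thesis .
  qed
qed

lemma fps_conv_radius_geI_power:
  fixes F :: "'a::{banach, real_normed_div_algebra} fps"
  assumes "C > 0" "\<And>n. norm (fps_nth F n) \<le> C ^ n"
  shows "fps_conv_radius F \<ge> ereal (1 / C)"
  unfolding fps_conv_radius_def
proof (rule conv_radius_geI_ex')
  fix r :: real
  assume r: "0 < r" "ereal r < ereal (1 / C)"
  show "summable (\<lambda>n. fps_nth F n * of_real r ^ n)"
  proof (rule summable_comparison_test')
    show "summable (\<lambda>n. (C * r) ^ n)"
      using assms(1) r by (intro summable_geometric) (simp add: field_simps)
    show "norm (fps_nth F n * of_real r ^ n) \<le> (C * r) ^ n" for n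
      using assms(2)[of n] r by (simp add: norm_mult norm_power power_mult_distrib mult_right_mono)
  qed
qed

lemma sturm_liouville_powser:
  fixes u :: "nat \<Rightarrow> 'a::{banach, real_normed_field}"
  assumes "C > 0" "\<And>n. norm (u n) \<le> C ^ n"
    and "p\<^sub>1 * u 1 = q\<^sub>0 * u 0"
    and "\<And>n. (of_nat n + 2) * (p\<^sub>1 * (of_nat n + 2) * u (n + 2) +
        p\<^sub>2 * (of_nat n + 1) * u (n + 1) + p\<^sub>3 * of_nat n * u n) = q\<^sub>0 * u (n + 1) + q\<^sub>1 * u n"
  shows "sturm_liouville (poly [:0, p\<^sub>1, p\<^sub>2, p\<^sub>3:]) (poly [:q\<^sub>0, q\<^sub>1:]) (\<lambda>z. \<Sum>n. u n * z ^ n) 0"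
proof -
  have "0 < ereal (1 / C)"
    using \<open>C > 0\<close> by simp
  also have "\<dots> \<le> fps_conv_radius (Abs_fps u)"
    using assms(1,2) by (intro fps_conv_radius_geI_power) simp_all
  finally have "sturm_liouville (eval_fps (fps_of_poly [:0, p\<^sub>1, p\<^sub>2, p\<^sub>3:]))
      (eval_fps (fps_of_poly [:q\<^sub>0, q\<^sub>1:])) (eval_fps (Abs_fps u)) 0"
    using assms(3,4)
    by (intro sturm_liouville_eval_fps fps_sturm_liouville_recurrence) simp_all
  moreover have "eval_fps (fps_of_poly p) = poly p" for p :: "'a poly"
    by (simp add: fun_eq_iff)
  moreover have "eval_fps (Abs_fps u) = (\<lambda>z. \<Sum>n. u n * z ^ n)"
    by (simp add: fun_eq_iff eval_fps_def)
  ultimately show ?thesis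
    by simp
qed

subsection \<open>Apery's recurrence\<close>

lemma of_nat_Suc_times_binomial_Suc:
  "(of_nat k + 1) * of_nat (Suc n choose Suc k) =
     (of_nat n + 1) * (of_nat (n choose k) :: 'a::comm_ring_1)"
proof -
  have "of_nat (Suc k * (Suc n choose Suc k)) = (of_nat (Suc n * (n choose k)) :: 'a)"
    by (simp only: Suc_times_binomial)
  thus ?thesis
    by (simp only: of_nat_mult of_nat_Suc add.commute)
qed

lemma of_nat_diff_times_binomial_Suc:
  "(of_nat n + 1 - of_nat k) * of_nat (Suc n choose k) =
     (of_nat n + 1) * (of_nat (n choose k) :: 'a::comm_ring_1)"
proof (cases k)
  case (Suc j)
  thus ?thesis
    using of_nat_Suc_times_binomial_Suc[of j n, where ?'a = 'a] by (simp add: algebra_simps)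
qed simp

lemma of_nat_Suc_times_binomial:
  "(of_nat k + 1) * of_nat (n choose Suc k) =
     (of_nat n - of_nat k) * (of_nat (n choose k) :: 'a::comm_ring_1)"
  using of_nat_Suc_times_binomial_Suc[of k n, where ?'a = 'a] by (simp add: algebra_simps)

lemma of_nat_Suc_times_binomial_add:
  "(of_nat n + 1) * of_nat (Suc (n + k) choose k) =
     (of_nat n + of_nat k + 1) * (of_nat ((n + k) choose k) :: 'a::comm_ring_1)"
  using of_nat_diff_times_binomial_Suc[of "n + k" k, where ?'a = 'a] by simp

definition apery_term :: "nat \<Rightarrow> nat \<Rightarrow> real" where
  "apery_term n k = real (n choose k) ^ 2 * real ((n + k) choose k)"

lemma apery_coeff_eq_sum:
  assumes "n \<le> m"
  shows "real (apery_coeff n) = (\<Sum>k\<le>m. apery_term n k)"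
proof -
  have "real (apery_coeff n) = (\<Sum>k\<le>n. apery_term n k)"
    by (simp add: apery_coeff_def apery_term_def atLeast0AtMost)
  also have "\<dots> = (\<Sum>k\<le>m. apery_term n k)"
    using assms by (intro sum.mono_neutral_left) (auto simp: apery_term_def)
  finally show ?thesis .
qed

lemma apery_term_Suc:
  "(real n + 1 - real k) ^ 2 * apery_term (Suc n) k =
     (real n + 1) * (real n + real k + 1) * apery_term n k"
proof -
  have "(real n + 1) * ((real n + 1 - real k) ^ 2 * apery_term (Suc n) k) =
      ((real n + 1 - real k) * real (Suc n choose k)) ^ 2 *
      ((real n + 1) * real (Suc (n + k) choose k))"
    by (simp add: apery_term_def power_mult_distrib)
  also have "\<dots> = (real n + 1) * ((real n + 1) * (real n + real k + 1) * apery_term n k)"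
    unfolding of_nat_diff_times_binomial_Suc of_nat_Suc_times_binomial_add
    by (simp add: apery_term_def power2_eq_square)
  finally show ?thesis by simp
qed

lemma apery_term_Suc_right:
  "(real k + 1) ^ 3 * apery_term n (Suc k) =
     (real n + real k + 1) * (real n - real k) ^ 2 * apery_term n k"
proof -
  have "(real k + 1) ^ 3 * apery_term n (Suc k) =
      ((real k + 1) * real (n choose Suc k)) ^ 2 *
      ((real k + 1) * real (Suc (n + k) choose Suc k))"
    by (simp add: apery_term_def power_mult_distrib eval_nat_numeral)
  also have "\<dots> = (real n + real k + 1) * (real n - real k) ^ 2 * apery_term n k"
    unfolding of_nat_Suc_times_binomial_Suc unfolding of_nat_Suc_times_binomial
    by (simp add: apery_term_def power_mult_distrib)
  finally show ?thesis .
qed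

lemma apery_term_Suc_Suc:
  "(real k + 1) ^ 3 * apery_term (Suc n) (Suc k) =
     (real n + 1) * (real n + real k + 1) * (real n + real k + 2) * apery_term n k"
proof -
  have "(real n + 1) * ((real k + 1) ^ 3 * apery_term (Suc n) (Suc k)) =
      (real n + 1) * ((real k + 1) * real (Suc n choose Suc k)) ^ 2 *
      ((real k + 1) * real (Suc (Suc (n + k)) choose Suc k))"
    by (simp add: apery_term_def power_mult_distrib eval_nat_numeral)
  also have "\<dots> = ((real n + 1) * real (n choose k)) ^ 2 * (real n + real k + 2) *
      ((real n + 1) * real (Suc (n + k) choose k))"
    unfolding of_nat_Suc_times_binomial_Suc by (simp add: algebra_simps)
  also have "\<dots> = (real n + 1) *
      ((real n + 1) * (real n + real k + 1) * (real n + real k + 2) * apery_term n k)"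
    unfolding of_nat_Suc_times_binomial_add by (simp add: apery_term_def power2_eq_square)
  finally show ?thesis by simp
qed

lemma apery_term_pred_Suc:
  "(real n + 1) * (real k + 1) ^ 3 * apery_term n (Suc k) =
     (real n - real k) ^ 2 * (real n + 1 - real k) ^ 2 * apery_term (Suc n) k"
proof -
  have "(real n + real k + 2) * ((real n + 1) * (real k + 1) ^ 3 * apery_term n (Suc k)) =
      (real k + 1) ^ 3 * ((real n - real k) ^ 2 * apery_term (Suc n) (Suc k))"
    using apery_term_Suc[of n "Suc k"] by (simp add: algebra_simps)
  also have "\<dots> = (real n - real k) ^ 2 * ((real k + 1) ^ 3 * apery_term (Suc n) (Suc k))"
    by simp
  also have "\<dots> = (real n + real k + 2) *
      ((real n - real k) ^ 2 * (real n + 1 - real k) ^ 2 * apery_term (Suc n) k)"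
    unfolding apery_term_Suc_right by (simp add: algebra_simps)
  finally show ?thesis
    unfolding mult_cancel_left by linarith
qed

text \<open>The first factor is the Wilf--Zeilberger certificate of Apery's recurrence for \<open>\<zeta>(2)\<close>.\<close>

definition apery_cert :: "nat \<Rightarrow> nat \<Rightarrow> real" where
  "apery_cert n k =
     (real k ^ 2 + 3 * (2 * real n + 1) * real k - 11 * real n ^ 2 - 9 * real n - 2) *
     apery_term n k"

definition apery_operator :: "(nat \<Rightarrow> real) \<Rightarrow> nat \<Rightarrow> real" where
  "apery_operator u n = (real n + 2) ^ 2 * u (n + 2)
     - (11 * (real n + 1) ^ 2 + 11 * (real n + 1) + 3) * u (n + 1) - (real n + 1) ^ 2 * u n"

lemma apery_term_telescope:
  "apery_operator (\<lambda>n. apery_term n (Suc k)) n =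
     apery_cert (n + 1) (Suc k) - apery_cert (n + 1) k"
proof -
  define x y t where "x = real n" and "y = real k" and "t = apery_term (n + 1) k"
  have rel: "(y + 1) ^ 3 * apery_term (n + 2) (Suc k) = (x + 2) * (x + y + 2) * (x + y + 3) * t"
      "(y + 1) ^ 3 * apery_term (n + 1) (Suc k) = (x + y + 2) * (x + 1 - y) ^ 2 * t"
      "(x + 1) * (y + 1) ^ 3 * apery_term n (Suc k) = (x - y) ^ 2 * (x + 1 - y) ^ 2 * t"
    using apery_term_Suc_Suc[of k "n + 1"] apery_term_Suc_right[of k "n + 1"]
      apery_term_pred_Suc[of n k]
    by (simp_all add: x_def y_def t_def add_ac)
  have "(y + 1) ^ 3 * apery_operator (\<lambda>n. apery_term n (Suc k)) n =
      (y + 1) ^ 3 * (apery_cert (n + 1) (Suc k) - apery_cert (n + 1) k)"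
    using rel
    unfolding apery_operator_def apery_cert_def of_nat_add of_nat_Suc of_nat_1
      x_def[symmetric] y_def[symmetric] t_def[symmetric]
    by algebra
  moreover have "(y + 1) ^ 3 \<noteq> 0"
    by (simp add: y_def)
  ultimately show ?thesis by simp
qed

lemma apery_coeff_recurrence: "apery_operator (\<lambda>n. real (apery_coeff n)) n = 0"
proof -
  have "apery_operator (\<lambda>n. real (apery_coeff n)) n =
      (\<Sum>k\<le>n+2. apery_operator (\<lambda>n. apery_term n k) n)"
    by (simp only: apery_operator_def sum_subtractf sum_distrib_left
        apery_coeff_eq_sum[of _ "n + 2"] le_add1 order_refl add_left_mono one_le_numeral)
  also have "\<dots> = apery_operator (\<lambda>n. apery_term n 0) n +
      (\<Sum>k<n+2. apery_cert (n + 1) (Suc k) - apery_cert (n + 1) k)"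
    by (simp only: sum.atMost_shift apery_term_telescope)
  also have "\<dots> = apery_operator (\<lambda>n. apery_term n 0) n +
      apery_cert (n + 1) (n + 2) - apery_cert (n + 1) 0"
    by (simp only: sum_lessThan_telescope)
  also have "apery_cert (n + 1) (n + 2) = 0"
    by (simp add: apery_cert_def apery_term_def binomial_eq_0 del: binomial_Suc_Suc)
  also have "apery_operator (\<lambda>n. apery_term n 0) n + 0 - apery_cert (n + 1) 0 = 0"
    by (simp add: apery_operator_def apery_cert_def apery_term_def algebra_simps power2_eq_square)
  finally show ?thesis .
qed

lemma apery_coeff_le: "apery_coeff n \<le> 16 ^ n"
proof -
  have "apery_coeff n = (\<Sum>k\<le>n. (n choose k) ^ 2 * ((n + k) choose k))"
    by (simp add: apery_coeff_def atLeast0AtMost)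
  also have "\<dots> \<le> (\<Sum>k\<le>n. (n choose k) ^ 2 * 4 ^ n)"
  proof (intro sum_mono mult_left_mono)
    fix k assume "k \<in> {..n}"
    hence "(2::nat) ^ (n + k) \<le> 2 ^ (2 * n)"
      by (intro power_increasing) auto
    with binomial_le_pow2[of "n + k" k] show "(n + k) choose k \<le> 4 ^ n"
      by (simp add: power_mult)
  qed simp
  also have "\<dots> = (2 * n choose n) * 4 ^ n"
    by (simp flip: sum_distrib_right choose_square_sum)
  also have "\<dots> \<le> 4 ^ n * 4 ^ n"
    using binomial_le_pow2[of "2 * n" n] by (simp add: power_mult)
  also have "\<dots> = 16 ^ n"
    by (simp flip: power_mult_distrib)
  finally show ?thesis .
qed

subsection \<open>The equations of \<open>\<phi>\<close> and \<open>\<^sub>2F\<^sub>1\<close>\<close>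

lemma phi_sturm_liouville: "sturm_liouville (poly [:0, 1, -11, -1:]) (poly [:3, 1:]) phi 0"
  unfolding phi_def[abs_def]
proof (rule sturm_liouville_powser)
  show "norm (of_nat (apery_coeff n) :: complex) \<le> 16 ^ n" for n
    using of_nat_mono[OF apery_coeff_le[of n], where ?'a = real] by simp
  show "(of_nat n + 2) * (1 * (of_nat n + 2) * complex_of_nat (apery_coeff (n + 2)) +
      -11 * (of_nat n + 1) * of_nat (apery_coeff (n + 1)) +
      -1 * of_nat n * of_nat (apery_coeff n)) =
      3 * of_nat (apery_coeff (n + 1)) + 1 * of_nat (apery_coeff n)" for n
  proof -
    have "complex_of_real (apery_operator (\<lambda>n. real (apery_coeff n)) n) = 0"
      by (simp add: apery_coeff_recurrence)
    thus ?thesis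
      by (simp add: apery_operator_def algebra_simps power2_eq_square)
  qed
qed (simp_all add: apery_coeff_def)

definition hyp2F1_coeff :: "complex \<Rightarrow> complex \<Rightarrow> nat \<Rightarrow> complex" where
  "hyp2F1_coeff a b n = pochhammer a n * pochhammer b n / (pochhammer 1 n * fact n)"

lemma hyp2F1_coeff_Suc:
  "(of_nat n + 1) ^ 2 * hyp2F1_coeff a b (Suc n) =
     (a + of_nat n) * (b + of_nat n) * hyp2F1_coeff a b n"
proof -
  have "(of_nat n + 1 :: complex) \<noteq> 0"
    using of_nat_neq_0[of n, where ?'a = complex] by (simp add: add.commute)
  moreover have "hyp2F1_coeff a b (Suc n) =
      (a + of_nat n) * (b + of_nat n) * hyp2F1_coeff a b n / (of_nat n + 1) ^ 2"
    by (simp add: hyp2F1_coeff_def pochhammer_Suc power2_eq_square mult_ac add_ac)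
  ultimately show ?thesis
    by simp
qed

lemma norm_hyp2F1_coeff_le: "norm (hyp2F1_coeff a b n) \<le> ((norm a + 1) * (norm b + 1)) ^ n"
proof (induction n)
  case 0
  show ?case by (simp add: hyp2F1_coeff_def)
next
  case (Suc n)
  have norm_add_le: "norm (z + of_nat n) \<le> (norm z + 1) * (real n + 1)" for z :: complex
  proof -
    have "norm (z + of_nat n) \<le> norm z + real n"
      using norm_triangle_ineq[of z "of_nat n"] by simp
    also have "\<dots> \<le> (norm z + 1) * (real n + 1)"
      by (simp add: algebra_simps)
    finally show ?thesis .
  qed
  have "(real n + 1) ^ 2 * norm (hyp2F1_coeff a b (Suc n)) =
      norm ((of_nat n + 1) ^ 2 * hyp2F1_coeff a b (Suc n))"
    unfolding norm_mult norm_power by (metis norm_of_nat of_nat_Suc add.commute)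
  also have "\<dots> = norm (a + of_nat n) * norm (b + of_nat n) * norm (hyp2F1_coeff a b n)"
    by (simp add: hyp2F1_coeff_Suc norm_mult)
  also have "\<dots> \<le> ((norm a + 1) * (real n + 1)) * ((norm b + 1) * (real n + 1)) *
      ((norm a + 1) * (norm b + 1)) ^ n"
    by (intro mult_mono norm_add_le Suc.IH) auto
  also have "\<dots> = (real n + 1) ^ 2 * ((norm a + 1) * (norm b + 1)) ^ Suc n"
    by (simp add: power2_eq_square mult_ac)
  finally show ?case
    by (rule mult_left_le_imp_le) simp
qed

lemma hyp2F1_sturm_liouville:
  assumes "a + b = 1"
  shows "sturm_liouville (poly [:0, 1, -1:]) (poly [:a * b:]) (hyp2F1 a b 1) 0"
proof -
  let ?c = "hyp2F1_coeff a b"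
  have "(of_nat n + 2) * (1 * (of_nat n + 2) * ?c (n + 2) +
      -1 * (of_nat n + 1) * ?c (n + 1) + 0 * of_nat n * ?c n) =
      a * b * ?c (n + 1) + 0 * ?c n" for n
  proof -
    have "(of_nat n + 2) ^ 2 * ?c (n + 2) =
        (a + of_nat (n + 1)) * (b + of_nat (n + 1)) * ?c (n + 1)"
      using hyp2F1_coeff_Suc[of "n + 1" a b] by (simp add: add_ac)
    also have "(a + of_nat (n + 1)) * (b + of_nat (n + 1)) =
        (of_nat n + 2) * (of_nat n + 1) + a * b"
      using assms unfolding of_nat_add of_nat_1 by algebra
    finally show ?thesis
      by (simp add: algebra_simps power2_eq_square)
  qed
  moreover have "1 * ?c 1 = a * b * ?c 0"
    by (simp add: hyp2F1_coeff_def)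
  moreover have "(norm a + 1) * (norm b + 1) > 0"
    by (intro mult_pos_pos add_nonneg_pos) auto
  ultimately have "sturm_liouville (poly [:0, 1, -1, 0:]) (poly [:a * b, 0:])
      (\<lambda>z. \<Sum>n. ?c n * z ^ n) 0"
    using norm_hyp2F1_coeff_le by (intro sturm_liouville_powser)
  thus ?thesis
    by (simp add: hyp2F1_def[abs_def] hyp2F1_coeff_def)
qed

subsection \<open>Algebraic pullbacks\<close>

lemma eventually_poly_nonzero:
  fixes p :: "'a::real_normed_field poly"
  assumes "poly p a \<noteq> 0"
  shows "\<forall>\<^sub>F x in nhds a. poly p x \<noteq> 0"
  using assms by (intro isCont_imp_eventually_ne) simp_all

text \<open>
  The polynomial identities assumed for \<open>P\<close> and \<open>R\<close> are the hypotheses of \<open>sturm_liouville_compose\<close>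
  and of \<open>sturm_liouville_divide\<close> or \<open>sturm_liouville_divide_csqrt\<close>, with denominators cleared.
\<close>

lemma phi_compose_sturm_liouville:
  fixes P v w :: "complex poly"
  defines "V \<equiv> pderiv v * w - v * pderiv w"
  assumes at_a: "poly v a = 0" "poly w a \<noteq> 0"
    and P: "P * V = smult c (v * w * (w ^ 2 - 11 * v * w - v ^ 2))"
  shows "sturm_liouville (\<lambda>k. poly P k / poly w k ^ 2)
    (\<lambda>k. c * poly [:3, 1:] (poly v k / poly w k) * (poly V k / poly w k ^ 2))
    (\<lambda>k. phi (poly v k / poly w k)) a"
proof (rule sturm_liouville_compose)
  have w: "\<forall>\<^sub>F k in nhds a. poly w k \<noteq> 0"
    using at_a(2) by (rule eventually_poly_nonzero)
  show "sturm_liouville (poly [:0, 1, -11, -1:]) (poly [:3, 1:]) phi (poly v a / poly w a)"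
    using phi_sturm_liouville by (simp add: at_a)
  show "\<forall>\<^sub>F k in nhds a. ((\<lambda>k. poly v k / poly w k) has_field_derivative
      poly V k / poly w k ^ 2) (at k)"
    using w
    by eventually_elim (auto intro!: derivative_eq_intros simp: V_def power2_eq_square)
  show "\<forall>\<^sub>F k in nhds a. poly P k / poly w k ^ 2 * (poly V k / poly w k ^ 2) =
      c * poly [:0, 1, -11, -1:] (poly v k / poly w k)"
    using w
  proof eventually_elim
    case (elim k)
    have "poly P k / poly w k ^ 2 * (poly V k / poly w k ^ 2) = poly (P * V) k / poly w k ^ 4"
      by simp
    also have "\<dots> = c * poly [:0, 1, -11, -1:] (poly v k / poly w k)"
      unfolding P using elim by (simp add: field_simps eval_nat_numeral)
    finally show ?case .
  qed
qed

lemma phi_pullback_sturm_liouville: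
  fixes P R v w :: "complex poly"
  defines "V \<equiv> pderiv v * w - v * pderiv w"
  assumes at_a: "poly v a = 0" "poly w a \<noteq> 0"
    and P: "P * V = smult c (v * w * (w ^ 2 - 11 * v * w - v ^ 2))"
    and R: "R * w ^ 2 =
      smult c ((3 * w + v) * w * V) - pderiv (P * pderiv w) * w + 2 * P * pderiv w ^ 2"
  shows "sturm_liouville (poly P) (poly R) (\<lambda>k. phi (poly v k / poly w k) / poly w k) a"
proof (rule sturm_liouville_divide)
  show "sturm_liouville (\<lambda>k. poly P k / poly w k ^ 2)
      (\<lambda>k. c * poly [:3, 1:] (poly v k / poly w k) * (poly V k / poly w k ^ 2))
      (\<lambda>k. phi (poly v k / poly w k)) a"
    using at_a P unfolding V_def by (rule phi_compose_sturm_liouville)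
  show "\<forall>\<^sub>F k in nhds a. (poly w has_field_derivative poly (pderiv w) k) (at k)"
    by simp
  show "\<forall>\<^sub>F k in nhds a. ((\<lambda>k. poly P k * poly (pderiv w) k) has_field_derivative
      poly (pderiv (P * pderiv w)) k) (at k)"
    by (simp flip: poly_mult)
  show w: "\<forall>\<^sub>F k in nhds a. poly w k \<noteq> 0"
    using at_a(2) by (rule eventually_poly_nonzero)
  show "\<forall>\<^sub>F k in nhds a. poly R k * poly w k ^ 2 =
      c * poly [:3, 1:] (poly v k / poly w k) * (poly V k / poly w k ^ 2) * poly w k ^ 4
      - poly (pderiv (P * pderiv w)) k * poly w k + 2 * poly P k * poly (pderiv w) k ^ 2"
    using w
  proof eventually_elim
    case (elim k)
    hence "c * poly [:3, 1:] (poly v k / poly w k) * (poly V k / poly w k ^ 2) * poly w k ^ 4 =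
        poly (smult c ((3 * w + v) * w * V)) k"
      by (simp add: field_simps eval_nat_numeral)
    thus ?case
      using arg_cong[OF R, of "\<lambda>p. poly p k"] by (simp del: poly_smult)
  qed
qed

lemma hyp2F1_compose_sturm_liouville:
  fixes P D v :: "complex poly"
  defines "V \<equiv> pderiv v * D - 2 * v * pderiv D"
  assumes sum_1: "\<alpha> + \<beta> = 1"
    and at_a: "poly v a = 0" "poly D a \<noteq> 0"
    and P: "P * V = smult c (v * (D ^ 2 - v))"
  shows "sturm_liouville (\<lambda>k. poly P k / poly D k)
    (\<lambda>k. c * poly [:\<alpha> * \<beta>:] (poly v k / poly D k ^ 2) * (poly V k / poly D k ^ 3))
    (\<lambda>k. hyp2F1 \<alpha> \<beta> 1 (poly v k / poly D k ^ 2)) a"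
proof (rule sturm_liouville_compose)
  have D: "\<forall>\<^sub>F k in nhds a. poly D k \<noteq> 0"
    using at_a(2) by (rule eventually_poly_nonzero)
  show "sturm_liouville (poly [:0, 1, -1:]) (poly [:\<alpha> * \<beta>:]) (hyp2F1 \<alpha> \<beta> 1)
      (poly v a / poly D a ^ 2)"
    using hyp2F1_sturm_liouville[OF sum_1] by (simp add: at_a)
  show "\<forall>\<^sub>F k in nhds a. ((\<lambda>k. poly v k / poly D k ^ 2) has_field_derivative
      poly V k / poly D k ^ 3) (at k)"
    using D by eventually_elim
      (auto intro!: derivative_eq_intros simp: V_def field_simps eval_nat_numeral)
  show "\<forall>\<^sub>F k in nhds a. poly P k / poly D k * (poly V k / poly D k ^ 3) =
      c * poly [:0, 1, -1:] (poly v k / poly D k ^ 2)"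
    using D
  proof eventually_elim
    case (elim k)
    have "poly P k / poly D k * (poly V k / poly D k ^ 3) = poly (P * V) k / poly D k ^ 4"
      by (simp add: eval_nat_numeral)
    also have "\<dots> = c * poly [:0, 1, -1:] (poly v k / poly D k ^ 2)"
      unfolding P using elim by (simp add: field_simps eval_nat_numeral)
    finally show ?case .
  qed
qed

lemma hyp2F1_pullback_sturm_liouville:
  fixes P R D v :: "complex poly"
  defines "V \<equiv> pderiv v * D - 2 * v * pderiv D"
  assumes sum_1: "\<alpha> + \<beta> = 1"
    and at_a: "poly v a = 0" "poly D a \<notin> \<real>\<^sub>\<le>\<^sub>0"
    and P: "P * V = smult c (v * (D ^ 2 - v))"
    and R: "4 * R * D ^ 2 =
      smult (4 * c * \<alpha> * \<beta>) V + 3 * P * pderiv D ^ 2 - 2 * pderiv (P * pderiv D) * D"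
  shows "sturm_liouville (poly P) (poly R)
    (\<lambda>k. hyp2F1 \<alpha> \<beta> 1 (poly v k / poly D k ^ 2) / csqrt (poly D k)) a"
proof (rule sturm_liouville_divide_csqrt)
  have "poly D a \<noteq> 0"
    using at_a(2) by auto
  with sum_1 at_a(1) show "sturm_liouville (\<lambda>k. poly P k / poly D k)
      (\<lambda>k. c * poly [:\<alpha> * \<beta>:] (poly v k / poly D k ^ 2) * (poly V k / poly D k ^ 3))
      (\<lambda>k. hyp2F1 \<alpha> \<beta> 1 (poly v k / poly D k ^ 2)) a"
    using P unfolding V_def by (rule hyp2F1_compose_sturm_liouville)
  show "\<forall>\<^sub>F k in nhds a. (poly D has_field_derivative poly (pderiv D) k) (at k)"
    by simp
  show "\<forall>\<^sub>F k in nhds a. ((\<lambda>k. poly P k * poly (pderiv D) k) has_field_derivative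
      poly (pderiv (P * pderiv D)) k) (at k)"
    by (simp flip: poly_mult)
  have "\<forall>\<^sub>F k in nhds a. poly D k \<noteq> 0"
    using \<open>poly D a \<noteq> 0\<close> by (rule eventually_poly_nonzero)
  thus "\<forall>\<^sub>F k in nhds a. 4 * poly R k * poly D k ^ 2 =
      4 * (c * poly [:\<alpha> * \<beta>:] (poly v k / poly D k ^ 2) * (poly V k / poly D k ^ 3)) *
        poly D k ^ 3
      + 3 * poly P k * poly (pderiv D) k ^ 2 - 2 * poly (pderiv (P * pderiv D)) k * poly D k"
  proof eventually_elim
    case (elim k)
    thus ?case
      using arg_cong[OF R, of "\<lambda>p. poly p k"] by (simp add: mult_ac)
  qed
qed (rule at_a)

subsection \<open>The common equation of level 10\<close>

text \<open>
  If \<open>k = r(q) r(q\<^sup>2)\<^sup>2\<close> for the Rogers--Ramanujan continued fraction \<open>r\<close>, then the arguments of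
  \<open>\<phi>\<close> are \<open>r(q)\<^sup>5\<close> and \<open>r(q\<^sup>2)\<^sup>5\<close>, and those of \<open>\<^sub>2F\<^sub>1\<close> are the values at \<open>q\<^sup>5\<close> and \<open>q\<close> of
  \<open>64h/(1 + 64h)\<close>, where \<open>h(q) = q \<Prod>\<^sub>n (1 + q\<^sup>n)\<^sup>2\<^sup>4\<close>.
\<close>

definition level10_p :: "complex poly" where
  "level10_p = [:0, 1:] * [:1, 0, -1:] * [:1, -4, -1:] * [:1, 1, -1:]"

definition level10_q :: "complex poly" where
  "level10_q = [:1, 9, -16, -30, 19, 9:]"

definition level10_solution :: "(complex \<Rightarrow> complex) \<Rightarrow> bool" where
  "level10_solution f \<longleftrightarrow> sturm_liouville (poly level10_p) (poly level10_q) f 0 \<and> f 0 = 1"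

lemma level10_solution_unique:
  assumes "level10_solution f" "level10_solution g"
  shows "\<forall>\<^sub>F k in nhds 0. f k = g k"
proof -
  have p_0: "poly level10_p 0 = 0"
    by (simp add: level10_p_def)
  have "\<forall>\<^sub>F k in nhds 0. poly ([:1, 0, -1:] * [:1, -4, -1:] * [:1, 1, -1:]) k \<noteq> (0::complex)"
    by (rule eventually_poly_nonzero) simp
  hence "\<forall>\<^sub>F k in at 0. poly level10_p k \<noteq> 0"
    unfolding eventually_at_filter by eventually_elim
      (simp add: level10_p_def del: mult_pCons_left mult_pCons_right)
  with p_0 have "\<forall>\<^sub>F k in nhds 0. f k * g 0 = f 0 * g k"
    using assms by (intro sturm_liouville_proportional) (auto simp: level10_solution_def)
  thus ?thesis
    using assms by (simp add: level10_solution_def)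
qed

lemmas level10_poly_simps =
  level10_p_def level10_q_def eval_nat_numeral numeral_poly pderiv_mult pderiv_pCons

lemma phi_0 [simp]: "phi 0 = 1"
  unfolding phi_def powser_zero by (simp add: apery_coeff_def)

lemma hyp2F1_0 [simp]: "hyp2F1 a b c 0 = 1"
  unfolding hyp2F1_def powser_zero by simp

lemma level10_solution_phi_q:
  "level10_solution (\<lambda>k. phi (k * ((1 - k) / (1 + k))^2) / (1 + k)^2)"
proof -
  define v w :: "complex poly" where "v = [:0, 1:] * [:1, -1:] ^ 2" and "w = [:1, 1:] ^ 2"
  have "sturm_liouville (poly level10_p) (poly level10_q)
      (\<lambda>k. phi (poly v k / poly w k) / poly w k) 0"
    by (rule phi_pullback_sturm_liouville[where c = 1])
      (simp_all add: v_def w_def level10_poly_simps)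
  thus ?thesis
    by (simp add: level10_solution_def v_def w_def power_divide
        del: mult_pCons_left mult_pCons_right)
qed

lemma level10_solution_phi_q2:
  "level10_solution (\<lambda>k. phi (k^2 * (1 + k) / (1 - k)) / (1 - k))"
proof -
  define v w :: "complex poly" where "v = [:0, 1:] ^ 2 * [:1, 1:]" and "w = [:1, -1:]"
  have "sturm_liouville (poly level10_p) (poly level10_q)
      (\<lambda>k. phi (poly v k / poly w k) / poly w k) 0"
    by (rule phi_pullback_sturm_liouville[where c = 2])
      (simp_all add: v_def w_def level10_poly_simps)
  thus ?thesis
    by (simp add: level10_solution_def v_def w_def del: mult_pCons_left mult_pCons_right)
qed

lemma level10_solution_hyp2F1_q5:
  "level10_solution (\<lambda>k. hyp2F1 (1/4) (3/4) 1
      (64 * k^5 * (1 + k - k^2) / ((1 + k^2)^2 * ((1 - k - k^2)^2 - 5 * k^2)^2)) /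
    csqrt ((1 + k^2) * ((1 - k - k^2)^2 - 5 * k^2)))"
proof -
  define v D :: "complex poly" where "v = [:64:] * [:0, 1:] ^ 5 * [:1, 1, -1:]"
    and "D = [:1, 0, 1:] * ([:1, -1, -1:] ^ 2 - [:0, 0, 5:])"
  have "sturm_liouville (poly level10_p) (poly level10_q)
      (\<lambda>k. hyp2F1 (1/4) (3/4) 1 (poly v k / poly D k ^ 2) / csqrt (poly D k)) 0"
    by (rule hyp2F1_pullback_sturm_liouville[where c = 5])
      (simp_all add: v_def D_def level10_poly_simps)
  moreover have "poly v k = 64 * k^5 * (1 + k - k^2)"
      "poly D k = (1 + k^2) * ((1 - k - k^2)^2 - 5 * k^2)" for k
    by (simp_all add: v_def D_def del: mult_pCons_left mult_pCons_right, algebra+)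
  ultimately show ?thesis
    by (simp add: level10_solution_def power_mult_distrib)
qed

lemma level10_solution_hyp2F1_q:
  "level10_solution (\<lambda>k. hyp2F1 (1/4) (3/4) 1
      (64 * k * (1 + k - k^2)^5 / ((1 + k^2)^2 * ((1 + 11 * k - k^2)^2 - 125 * k^2)^2)) /
    csqrt ((1 + k^2) * ((1 + 11 * k - k^2)^2 - 125 * k^2)))"
proof -
  define v D :: "complex poly" where "v = [:64:] * [:0, 1:] * [:1, 1, -1:] ^ 5"
    and "D = [:1, 0, 1:] * ([:1, 11, -1:] ^ 2 - [:0, 0, 125:])"
  have "sturm_liouville (poly level10_p) (poly level10_q)
      (\<lambda>k. hyp2F1 (1/4) (3/4) 1 (poly v k / poly D k ^ 2) / csqrt (poly D k)) 0"
    by (rule hyp2F1_pullback_sturm_liouville[where c = 1])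
      (simp_all add: v_def D_def level10_poly_simps)
  moreover have "poly v k = 64 * k * (1 + k - k^2)^5"
      "poly D k = (1 + k^2) * ((1 + 11 * k - k^2)^2 - 125 * k^2)" for k
    by (simp_all add: v_def D_def del: mult_pCons_left mult_pCons_right, algebra+)
  ultimately show ?thesis
    by (simp add: level10_solution_def power_mult_distrib)
qed

theorem mainTheorem14:
  shows "\<exists>\<epsilon>>0. \<forall>k::complex. norm k < \<epsilon> \<longrightarrow>
     phi (k * ((1 - k) / (1 + k))^2) =
       (1 + k)^2 / csqrt ((1 + k^2) * ((1 - k - k^2)^2 - 5 * k^2))
       * hyp2F1 (1/4) (3/4) 1
           (64 * k^5 * (1 + k - k^2) /
            ((1 + k^2)^2 * ((1 - k - k^2)^2 - 5 * k^2)^2))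
   \<and> phi (k^2 * (1 + k) / (1 - k)) =
       (1 - k) / csqrt ((1 + k^2) * ((1 + 11 * k - k^2)^2 - 125 * k^2))
       * hyp2F1 (1/4) (3/4) 1
           (64 * k * (1 + k - k^2)^5 /
            ((1 + k^2)^2 * ((1 + 11 * k - k^2)^2 - 125 * k^2)^2))
   \<and> phi (k^2 * (1 + k) / (1 - k)) =
       (1 - k) / (1 + k)^2 * phi (k * ((1 - k) / (1 + k))^2)"
proof -
  have nonzero: "\<forall>\<^sub>F k::complex in nhds 0. 1 + k \<noteq> 0" "\<forall>\<^sub>F k::complex in nhds 0. 1 - k \<noteq> 0"
    using eventually_poly_nonzero[of "[:1, 1:]" 0] eventually_poly_nonzero[of "[:1, -1:]" 0]
    by simp_all
  have clear_divisor: "x = y / d * z" if "x / y = z / d" "y \<noteq> 0" for x y z d :: complex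
    using that
    by (metis nonzero_divide_eq_eq times_divide_eq_left times_divide_eq_right mult.commute)
  show ?thesis
    unfolding
      eventually_nhds_metric[where a = "0::complex", unfolded dist_norm diff_zero, symmetric]
    using level10_solution_unique[OF level10_solution_phi_q level10_solution_hyp2F1_q5]
      level10_solution_unique[OF level10_solution_phi_q2 level10_solution_hyp2F1_q]
      level10_solution_unique[OF level10_solution_phi_q2 level10_solution_phi_q] nonzero
    by eventually_elim (intro conjI clear_divisor; (assumption | simp))
qed

end
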